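(* Let $n\ge 1$, and let $Q'_n=\mathcal{PC}_n\setminus Q_n$. Then $|Q_n|=|Q'_n|=s_n$, the (small) Schröder number.
   Context: Let $X_n=\{1,2,\ldots,n\}$ with its natural order. A partial transformation of $X_n$ is a map $\alpha:\mathrm{Dom}\,\alpha\to X_n$ with $\mathrm{Dom}\,\alpha\subseteq X_n$ (the empty map is allowed); $x\alpha$ denotes the image of $x$. It is decreasing if $x\alpha\le x$ for all $x\in\mathrm{Dom}\,\alpha$, and order-preserving if $x\le y$ implies $x\alpha\le y\alpha$ for all $x,y\in\mathrm{Dom}\,\alpha$. $\mathcal{PC}_n$ is the set of all decreasing and order-preserving partial transformations of $X_n$, and $Q_n=\{\alpha\in\mathcal{PC}_n:1\in\mathrm{Dom}\,\alpha\}$. The large (double) Schröder number is $r_n=\frac{1}{n+1}\sum_{r=0}^{n}\binom{n+1}{n-r}\binom{n+r}{r}$, and the small Schröder number is $s_0=1$, $s_n=r_n/2$ for $n\ge 1$. *)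

theory Defs
  imports Complex_Main
begin

definition partial_transformations :: "nat \<Rightarrow> (nat \<rightharpoonup> nat) set" where
  "partial_transformations n = {\<alpha>. dom \<alpha> \<subseteq> {1..n} \<and> ran \<alpha> \<subseteq> {1..n}}"

definition decreasing :: "(nat \<rightharpoonup> nat) \<Rightarrow> bool" where
  "decreasing \<alpha> \<longleftrightarrow> (\<forall>x \<in> dom \<alpha>. the (\<alpha> x) \<le> x)"

definition order_preserving :: "(nat \<rightharpoonup> nat) \<Rightarrow> bool" where
  "order_preserving \<alpha> \<longleftrightarrow>
     (\<forall>x \<in> dom \<alpha>. \<forall>y \<in> dom \<alpha>. x \<le> y \<longrightarrow> the (\<alpha> x) \<le> the (\<alpha> y))"

definition PC :: "nat \<Rightarrow> (nat \<rightharpoonup> nat) set" where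
  "PC n = {\<alpha> \<in> partial_transformations n. decreasing \<alpha> \<and> order_preserving \<alpha>}"

definition Q :: "nat \<Rightarrow> (nat \<rightharpoonup> nat) set" where
  "Q n = {\<alpha> \<in> PC n. 1 \<in> dom \<alpha>}"

(* Rational-valued, so that the divisions by n + 1 and by 2 are exact rather than truncating. *)

definition large_schroeder :: "nat \<Rightarrow> rat" where
  "large_schroeder n =
     1 / of_nat (n + 1) * (\<Sum>r = 0..n. of_nat ((n + 1) choose (n - r)) * of_nat ((n + r) choose r))"

definition small_schroeder :: "nat \<Rightarrow> rat" where
  "small_schroeder n = (if n = 0 then 1 else large_schroeder n / 2)"

end

theory Submission
  imports Defs
begin

text \<open>
  A decreasing map that is defined at \<open>1\<close> sends \<open>1\<close> to \<open>1\<close>, and since \<open>1\<close> is the least point with the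
  least possible value, the assignment \<open>1 \<mapsto> 1\<close> can be added to or removed from any map in
  \<open>PC n\<close> without destroying monotonicity. Hence \<open>Q n\<close> and its complement are equinumerous
  (\<open>bij_betw_Q\<close>), and it remains to see that \<open>PC n\<close> is counted by the large Schroeder number.

  The summands of the Schroeder number turn out to count the maps in \<open>PC n\<close> by the size \<open>r\<close> of their
  domain. To set up a recursion, one also bounds the values by a number \<open>k\<close>. Looking at the top point
  of the domain gives, for the number \<open>N(n,r,k)\<close> of these maps and \<open>k \<le> n + 1\<close>,
  \[ N(n+1,r+1,k) = N(n,r+1,k) + \sum_{j=1}^{k} N(n,r,j) \]
  (\<open>card_PC_slice_Suc\<close>). Without the condition that the maps be decreasing, the count would be
  the product of \<open>n choose r\<close> (domains) and \<open>(k + r - 1) choose r\<close> (weakly increasing sequences of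
  values). By Pascal's rule this product satisfies the difference form of the recursion,
  \[ N(n+1,r+1,k) - N(n+1,r+1,k-1) = N(n,r+1,k) - N(n,r+1,k-1) + N(n,r,k) \]
  and so does every product of two binomial coefficients obtained from it by shifting the arguments
  by constants. What the decreasing condition adds is the boundary condition
  \[ N(n,r,n+1) = N(n,r,n) \]
  because a value never exceeds \<open>n\<close>. Subtracting a shifted product that restores this condition gives
  the true count, much as in the reflection principle for lattice paths:
  \[ N(n,r,k) = {n \choose r}{k+r-1 \choose r} - {n-1 \choose r-1}{k+r-1 \choose r+1} \]
  (\<open>card_PC_slice\<close>). At \<open>k = n\<close> the difference collapses to the \<open>r\<close>-th summand of the Schroeder number.
\<close>

section \<open>Maps in \<open>PC n\<close> and the point 1\<close>

lemma PC_iff: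
  "\<alpha> \<in> PC n \<longleftrightarrow> dom \<alpha> \<subseteq> {1..n} \<and> (\<forall>x y. \<alpha> x = Some y \<longrightarrow> 1 \<le> y \<and> y \<le> x) \<and>
     (\<forall>x x' y y'. \<alpha> x = Some y \<longrightarrow> \<alpha> x' = Some y' \<longrightarrow> x \<le> x' \<longrightarrow> y \<le> y')"
  (is "?L \<longleftrightarrow> ?R")
proof
  assume ?L
  then show ?R
    unfolding PC_def partial_transformations_def decreasing_def order_preserving_def
    by (auto simp: ran_def dom_def subset_iff) (metis option.sel)+
next
  assume R: ?R
  then have "ran \<alpha> \<subseteq> {1..n}"
    by (fastforce simp: ran_def dom_def subset_iff)
  with R show ?L
    unfolding PC_def partial_transformations_def decreasing_def order_preserving_def
    by (auto simp: dom_def)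
qed

lemma finite_PC: "finite (PC n)"
proof -
  have "PC n \<subseteq> (\<Union>A\<in>Pow {1..n}. {\<alpha>. dom \<alpha> = A \<and> ran \<alpha> \<subseteq> {1..n}})"
    by (auto simp: PC_def partial_transformations_def)
  moreover have "finite (\<Union>A\<in>Pow {1..n}. {\<alpha>::nat \<rightharpoonup> nat. dom \<alpha> = A \<and> ran \<alpha> \<subseteq> {1..n}})"
    by (intro finite_UN_I finite_set_of_finite_maps) (auto intro: finite_subset)
  ultimately show ?thesis
    by (rule finite_subset)
qed

lemma bij_betw_Q:
  assumes "n \<ge> 1"
  shows "bij_betw (\<lambda>\<alpha>. \<alpha>(1 \<mapsto> 1)) (PC n - Q n) (Q n)"
proof (rule bij_betw_byWitness[where f' = "\<lambda>\<alpha>. \<alpha>(1 := None)"])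
  show "\<forall>\<alpha>\<in>PC n - Q n. (\<alpha>(1 \<mapsto> 1))(1 := None) = \<alpha>"
    by (auto simp: Q_def fun_eq_iff)
  show "\<forall>\<alpha>\<in>Q n. (\<alpha>(1 := None))(1 \<mapsto> 1) = \<alpha>"
    by (fastforce simp: Q_def PC_iff fun_eq_iff)
  show "(\<lambda>\<alpha>. \<alpha>(1 \<mapsto> 1)) ` (PC n - Q n) \<subseteq> Q n"
  proof
    fix \<beta> assume "\<beta> \<in> (\<lambda>\<alpha>. \<alpha>(1 \<mapsto> 1)) ` (PC n - Q n)"
    then obtain \<alpha> where \<alpha>: "\<alpha> \<in> PC n" "\<beta> = \<alpha>(1 \<mapsto> 1)"
      by blast
    have "x \<ge> 1" if "\<alpha> x = Some y" for x y
      using \<alpha>(1) that by (auto simp: PC_iff)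
    with \<alpha> assms show "\<beta> \<in> Q n"
      unfolding Q_def PC_iff by (auto split: if_splits) (metis le_antisym)+
  qed
  show "(\<lambda>\<alpha>. \<alpha>(1 := None)) ` Q n \<subseteq> PC n - Q n"
    by (auto simp: Q_def PC_iff subset_iff domI split: if_splits)
qed

lemma card_PC_eq:
  assumes "n \<ge> 1"
  shows "card (PC n - Q n) = card (Q n)" "card (PC n) = 2 * card (Q n)"
proof -
  show eq: "card (PC n - Q n) = card (Q n)"
    using bij_betw_Q[OF assms] by (rule bij_betw_same_card)
  have "Q n \<subseteq> PC n"
    by (auto simp: Q_def)
  with eq show "card (PC n) = 2 * card (Q n)"
    using finite_PC[of n] by (simp add: card_Diff_subset finite_subset card_mono)
qed

section \<open>The recursion for maps with given domain size and bounded values\<close>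

definition PC_slice :: "nat \<Rightarrow> nat \<Rightarrow> nat \<Rightarrow> (nat \<rightharpoonup> nat) set" where
  "PC_slice n r k = {\<alpha> \<in> PC n. card (dom \<alpha>) = r \<and> ran \<alpha> \<subseteq> {..k}}"

lemma finite_PC_slice: "finite (PC_slice n r k)"
  using finite_PC by (rule rev_finite_subset) (auto simp: PC_slice_def)

lemma PC_slice_bound: "PC_slice n r (Suc n) = PC_slice n r n"
  by (fastforce simp: PC_slice_def PC_def partial_transformations_def)

lemma finite_dom_PC: "\<alpha> \<in> PC n \<Longrightarrow> finite (dom \<alpha>)"
  by (auto simp: PC_iff intro: finite_subset)

lemma PC_slice_0_right: "PC_slice n 0 k = {Map.empty}"
  by (auto simp: PC_slice_def finite_dom_PC) (auto simp: PC_iff)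

lemma PC_slice_0_left: "PC_slice 0 (Suc r) k = {}"
  by (auto simp: PC_slice_def PC_iff)

text \<open>A map that is defined at the top point \<open>n + 1\<close> with value \<open>j\<close> is an arbitrary smaller map with all
  values at most \<open>j\<close>, extended by one assignment. The bound on \<open>k\<close> makes every such \<open>j\<close> an admissible
  value at \<open>n + 1\<close>.\<close>

lemma PC_slice_Suc:
  assumes "k \<le> Suc n"
  shows "PC_slice (Suc n) (Suc r) k =
    PC_slice n (Suc r) k \<union> (\<Union>j\<in>{1..k}. (\<lambda>\<alpha>. \<alpha>(Suc n \<mapsto> j)) ` PC_slice n r j)"
    (is "?L = ?A \<union> ?B")
proof (intro equalityI subsetI)
  fix \<beta> assume \<beta>: "\<beta> \<in> ?L"
  then have PC: "\<beta> \<in> PC (Suc n)" and crd: "card (dom \<beta>) = Suc r" and ran: "ran \<beta> \<subseteq> {..k}"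
    by (auto simp: PC_slice_def)
  show "\<beta> \<in> ?A \<union> ?B"
  proof (cases "\<beta> (Suc n)")
    case None
    have "dom \<beta> \<subseteq> {1..n}"
    proof
      fix x assume "x \<in> dom \<beta>"
      then show "x \<in> {1..n}"
        using PC None by (cases "x = Suc n") (auto simp: PC_iff subset_iff le_Suc_eq)
    qed
    then have "\<beta> \<in> ?A"
      using PC crd ran by (auto simp: PC_slice_def PC_iff)
    then show ?thesis ..
  next
    case (Some j)
    define \<alpha> where "\<alpha> = \<beta>(Suc n := None)"
    have "\<alpha> \<in> PC n"
      using PC unfolding \<alpha>_def PC_iff by (fastforce simp: subset_iff le_Suc_eq split: if_splits)
    moreover have "card (dom \<alpha>) = r"
      using crd Some finite_dom_PC[OF PC] by (simp add: \<alpha>_def domI)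
    moreover have "ran \<alpha> \<subseteq> {..j}"
    proof
      fix y assume "y \<in> ran \<alpha>"
      then obtain x where x: "\<beta> x = Some y"
        by (auto simp: ran_def \<alpha>_def split: if_splits)
      then have "x \<le> Suc n"
        using PC by (auto simp: PC_iff)
      then show "y \<in> {..j}"
        using PC x Some unfolding PC_iff by blast
    qed
    ultimately have "\<alpha> \<in> PC_slice n r j"
      by (simp add: PC_slice_def)
    moreover have "\<beta> = \<alpha>(Suc n \<mapsto> j)"
      using Some by (auto simp: \<alpha>_def)
    moreover have "j \<in> {1..k}"
      using PC ran Some by (auto simp: PC_iff ran_def)
    ultimately show ?thesis
      by blast
  qed
next
  fix \<beta> assume "\<beta> \<in> ?A \<union> ?B"
  then consider "\<beta> \<in> ?A" | j \<alpha> where "1 \<le> j" "j \<le> k" "\<alpha> \<in> PC_slice n r j" "\<beta> = \<alpha>(Suc n \<mapsto> j)"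
    by auto
  then show "\<beta> \<in> ?L"
  proof cases
    case 1
    then show ?thesis
      by (auto simp: PC_slice_def PC_iff)
  next
    case 2
    then have PC: "\<alpha> \<in> PC n" and crd: "card (dom \<alpha>) = r" and ran: "ran \<alpha> \<subseteq> {..j}"
      by (auto simp: PC_slice_def)
    have le: "y \<le> j" "x \<le> n" if "\<alpha> x = Some y" for x y
      using ran PC that by (auto simp: ran_def PC_iff)
    have "Suc n \<notin> dom \<alpha>"
      using le(2) by fastforce
    then have "card (dom \<beta>) = Suc r"
      using 2 crd finite_dom_PC[OF PC] by simp
    moreover have "ran \<beta> \<subseteq> {..k}"
      using 2 le(1) by (fastforce simp: ran_def split: if_splits)
    moreover have "\<beta> \<in> PC (Suc n)"
      unfolding PC_iff
    proof (intro conjI allI impI)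
      show "dom \<beta> \<subseteq> {1..Suc n}"
        using PC 2 by (auto simp: PC_iff)
    next
      fix x y assume "\<beta> x = Some y"
      then show "1 \<le> y" "y \<le> x"
        using PC 2 assms by (auto simp: PC_iff split: if_splits)
    next
      fix x x' y y' assume "\<beta> x = Some y" "\<beta> x' = Some y'" "x \<le> x'"
      then show "y \<le> y'"
        using PC 2 le by (fastforce simp: PC_iff split: if_splits)
    qed
    ultimately show ?thesis
      by (simp add: PC_slice_def)
  qed
qed

lemma card_PC_slice_Suc:
  assumes "k \<le> Suc n"
  shows "card (PC_slice (Suc n) (Suc r) k) =
    card (PC_slice n (Suc r) k) + (\<Sum>j = 1..k. card (PC_slice n r j))"
proof -
  let ?B = "\<lambda>j. (\<lambda>\<alpha>. \<alpha>(Suc n \<mapsto> j)) ` PC_slice n r j"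
  have undef: "\<alpha> (Suc n) = None" if "\<alpha> \<in> PC_slice n s j" for \<alpha> s j
    using that by (force simp: PC_slice_def PC_iff)
  have "card (?B j) = card (PC_slice n r j)" for j
  proof (rule card_image, rule inj_onI)
    fix \<alpha> \<beta>
    assume "\<alpha> \<in> PC_slice n r j" "\<beta> \<in> PC_slice n r j" and eq: "\<alpha>(Suc n \<mapsto> j) = \<beta>(Suc n \<mapsto> j)"
    then have "\<alpha> (Suc n) = \<beta> (Suc n)"
      by (simp add: undef)
    moreover have "\<alpha> x = \<beta> x" if "x \<noteq> Suc n" for x
      using fun_cong[OF eq, of x] that by simp
    ultimately show "\<alpha> = \<beta>"
      by (metis ext)
  qed
  moreover have "?B i \<inter> ?B j = {}" if "i \<noteq> j" for i j
    using that by (auto dest: fun_cong[of _ _ "Suc n"])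
  then have "card (\<Union>j\<in>{1..k}. ?B j) = (\<Sum>j = 1..k. card (?B j))"
    by (intro card_UN_disjoint) (auto simp: finite_PC_slice)
  moreover have "PC_slice n (Suc r) k \<inter> (\<Union>j\<in>{1..k}. ?B j) = {}"
    using undef[of _ "Suc r" k] by fastforce
  then have "card (PC_slice n (Suc r) k \<union> (\<Union>j\<in>{1..k}. ?B j)) =
      card (PC_slice n (Suc r) k) + card (\<Union>j\<in>{1..k}. ?B j)"
    by (intro card_Un_disjoint) (auto simp: finite_PC_slice)
  ultimately show ?thesis
    by (simp add: PC_slice_Suc[OF assms])
qed

section \<open>The closed form\<close>

text \<open>The solution of the recursion for \<open>n = m + 1\<close>; the shift keeps the subtractions out of the
  arguments of the binomial coefficients.\<close>

fun slice_count :: "nat \<Rightarrow> nat \<Rightarrow> nat \<Rightarrow> int" where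
  "slice_count m 0 k = 1"
| "slice_count m (Suc r) k =
     int (Suc m choose Suc r) * int ((k + r) choose Suc r) - int (m choose r) * int ((k + r) choose (r + 2))"

text \<open>By Pascal's rule, taking differences of \<open>slice_count\<close> in both \<open>m\<close> and \<open>k\<close> lowers \<open>r\<close> by one, for
  each of the two products separately. Summing over \<open>k\<close> gives the recursion, because
  \<open>slice_count m (Suc r) 0 = 0\<close>.\<close>

lemma slice_count_Suc:
  "slice_count (Suc m) (Suc r) k = slice_count m (Suc r) k + (\<Sum>j = 1..k. slice_count m r j)"
proof (induction k)
  case 0
  show ?case by (simp add: binomial_eq_0)
next
  case (Suc k)
  then show ?case
    by (cases r) (simp_all add: algebra_simps)
qed

lemma binomial_Suc_right: "Suc k * ((n + k) choose Suc k) = n * ((n + k) choose k)"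
  using binomial_absorption[of k "n + k"] binomial_absorb_comp[of "n + k" k] by simp

text \<open>This is where the choice of the subtracted product matters. For \<open>n = m + 1\<close> and \<open>r > 0\<close> the
  difference of the two sides is
  \<open>(n choose r) * ((n + r - 1) choose (r - 1)) - ((n - 1) choose (r - 1)) * ((n + r - 1) choose r)\<close>,
  and both products are \<open>n / r\<close> times
  \<open>((n - 1) choose (r - 1)) * ((n + r - 1) choose (r - 1))\<close>.\<close>

lemma slice_count_bound: "slice_count m r (m + 2) = slice_count m r (m + 1)"
proof (cases r)
  case (Suc s)
  have 1: "int (Suc s) * int (Suc m choose Suc s) = int (Suc m) * int (m choose s)"
    using Suc_times_binomial[of s m] by (metis of_nat_mult)
  have 2: "int (Suc s) * int ((m + s + 1) choose Suc s) = int (Suc m) * int ((m + s + 1) choose s)"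
    unfolding of_nat_mult[symmetric] of_nat_eq_iff
    using binomial_Suc_right[of s "Suc m"] by (simp del: binomial_Suc_Suc)
  have "int (Suc s) * (int (Suc m choose Suc s) * int ((m + s + 1) choose s)) =
        int (Suc s) * (int (m choose s) * int ((m + s + 1) choose Suc s))"
    using 1 2 by algebra
  then have "int (Suc m choose Suc s) * int ((m + s + 1) choose s) =
        int (m choose s) * int ((m + s + 1) choose Suc s)"
    by (subst (asm) mult_cancel_left) simp
  then show ?thesis
    by (simp add: Suc algebra_simps)
qed simp

text \<open>The range of \<open>k\<close> has to reach \<open>n + 1\<close> (with \<open>n = m + 1\<close>): the recursion for \<open>n + 1\<close> draws on the
  slices for \<open>n\<close> with all bounds up to \<open>n + 1\<close>. It gives the count for \<open>n + 1\<close> only up to the bound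
  \<open>n + 1\<close>; at the bound \<open>n + 2\<close> neither the slice nor the formula changes any more, and this
  stability closes the induction.\<close>

lemma card_PC_slice:
  assumes "k \<le> m + 2"
  shows "int (card (PC_slice (Suc m) r k)) = slice_count m r k"
  using assms
proof (induction m arbitrary: r k)
  case 0
  have *: "int (card (PC_slice 1 r k)) = slice_count 0 r k" if "k \<le> 1" for k
  proof (cases r)
    case (Suc s)
    then show ?thesis
      using that card_PC_slice_Suc[of k 0 s]
      by (cases s; cases k) (simp_all add: PC_slice_0_left PC_slice_0_right)
  qed (simp add: PC_slice_0_right)
  from 0 consider "k \<le> 1" | "k = 2"
    by linarith
  then show ?case
    using *[of k] *[of 1] slice_count_bound[of 0 r] PC_slice_bound[of 1 r]
    by cases (simp_all add: numeral_2_eq_2)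
next
  case (Suc m)
  have *: "int (card (PC_slice (Suc (Suc m)) r k)) = slice_count (Suc m) r k" if "k \<le> m + 2" for k
  proof (cases r)
    case (Suc s)
    have "(\<Sum>j = 1..k. int (card (PC_slice (Suc m) s j))) = (\<Sum>j = 1..k. slice_count m s j)"
      using that Suc.IH by (intro sum.cong) auto
    then show ?thesis
      using that Suc.IH[of k "Suc s"] card_PC_slice_Suc[of k "Suc m" s]
      by (simp add: Suc slice_count_Suc del: slice_count.simps)
  qed (simp add: PC_slice_0_right)
  from Suc.prems consider "k \<le> m + 2" | "k = Suc (m + 2)"
    by linarith
  then show ?case
    using *[of k] *[of "m + 2"] slice_count_bound[of "Suc m" r] PC_slice_bound[of "Suc (Suc m)" r]
    by cases simp_all
qed

section \<open>Summation to the Schroeder number\<close>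

text \<open>With \<open>r = s + 1\<close>, absorption expresses every binomial coefficient involved as a rational multiple
  of either \<open>m choose s\<close> or \<open>(m + s + 1) choose (s + 1)\<close>. After clearing denominators, the identity
  reduces to \<open>(s + 2) * (m + 1) - (s + 1) * m = m + s + 2\<close>.\<close>

lemma slice_count_diagonal:
  "int (m + 2) * slice_count m r (Suc m) =
   int ((m + 2) choose Suc r) * int ((Suc m + r) choose r)"
proof (cases r)
  case (Suc s)
  let ?a = "int (m choose s)" and ?b = "int ((m + s + 1) choose Suc s)"
  let ?A = "int (Suc m choose Suc s)" and ?A' = "int ((m + 2) choose (s + 2))"
  let ?C = "int ((m + s + 1) choose (s + 2))" and ?D = "int ((m + s + 2) choose Suc s)"
  have A: "int (s + 1) * ?A = int (m + 1) * ?a"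
    using Suc_times_binomial[of s m] by (metis Suc_eq_plus1 of_nat_mult)
  have A': "int (s + 2) * ?A' = int (m + 2) * ?A"
    using Suc_times_binomial[of "Suc s" "Suc m"] by (metis add_2_eq_Suc' of_nat_mult)
  have C: "int (s + 2) * ?C = int m * ?b"
    using binomial_Suc_right[of "Suc s" m]
    by (metis Suc_eq_plus1 add.assoc add_2_eq_Suc' of_nat_mult)
  have D: "int (m + 1) * ?D = int (m + s + 2) * ?b"
  proof -
    have "m + s + 2 - Suc s = m + 1" "m + s + 2 - 1 = m + s + 1"
      by simp_all
    then show ?thesis
      using binomial_absorb_comp[of "m + s + 2" "Suc s"] by (metis of_nat_mult)
  qed
  have "int (s + 1) * int (s + 2) * (int (m + 2) * (?A * ?b - ?a * ?C)) =
        int (s + 1) * int (s + 2) * (?A' * ?D)"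
    using A A' C D unfolding of_nat_add of_nat_numeral of_nat_1 by algebra
  then have "int (m + 2) * (?A * ?b - ?a * ?C) = ?A' * ?D"
    by (subst (asm) mult_cancel_left) simp
  then show ?thesis
    by (simp add: Suc add_ac del: binomial_Suc_Suc)
qed simp

lemma card_PC_slice_diagonal:
  assumes "n \<ge> 1" "r \<le> n"
  shows "(n + 1) * card (PC_slice n r n) = ((n + 1) choose (n - r)) * ((n + r) choose r)"
proof -
  obtain m where m: "n = Suc m"
    using assms by (cases n) auto
  have "int ((n + 1) * card (PC_slice n r n)) = int ((n + 1) choose Suc r) * int ((n + r) choose r)"
    using card_PC_slice[of n m r] slice_count_diagonal[of m r] by (simp add: m distrib_right del: binomial_Suc_Suc)
  moreover have "(n + 1) choose Suc r = (n + 1) choose (n - r)"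
    using assms by (subst binomial_symmetric) auto
  ultimately show ?thesis
    by (metis of_nat_mult of_nat_eq_iff)
qed

lemma card_PC:
  assumes "n \<ge> 1"
  shows "of_nat (card (PC n)) = large_schroeder n"
proof -
  have "r \<le> n" if "\<alpha> \<in> PC n" "card (dom \<alpha>) = r" for \<alpha> r
    using that card_mono[of "{1..n}" "dom \<alpha>"] by (auto simp: PC_iff)
  then have "PC n = (\<Union>r\<in>{0..n}. PC_slice n r n)"
    by (fastforce simp: PC_slice_def PC_def partial_transformations_def)
  then have "card (PC n) = (\<Sum>r = 0..n. card (PC_slice n r n))"
    by (simp only:) (intro card_UN_disjoint, auto simp: finite_PC_slice, auto simp: PC_slice_def)
  then have "of_nat (n + 1) * of_nat (card (PC n)) =
      (\<Sum>r = 0..n. of_nat ((n + 1) * card (PC_slice n r n)) :: rat)"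
    by (simp add: sum_distrib_left distrib_right)
  also have "\<dots> = (\<Sum>r = 0..n. of_nat ((n + 1) choose (n - r)) * of_nat ((n + r) choose r))"
    using assms by (intro sum.cong refl, subst card_PC_slice_diagonal) auto
  also have "\<dots> = of_nat (n + 1) * large_schroeder n"
    unfolding large_schroeder_def by (simp del: of_nat_Suc of_nat_add)
  finally show ?thesis
    by (simp del: of_nat_Suc of_nat_add)
qed

theorem corollary3p3:
  fixes n :: nat
  assumes "n \<ge> 1"
  shows "of_nat (card (Q n)) = small_schroeder n \<and>
         of_nat (card (PC n - Q n)) = small_schroeder n"
proof -
  have "2 * of_nat (card (Q n)) = large_schroeder n"
    using card_PC[OF assms] card_PC_eq(2)[OF assms] by simp
  then have "of_nat (card (Q n)) = small_schroeder n"
    using assms by (simp add: small_schroeder_def)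
  with card_PC_eq(1)[OF assms] show ?thesis
    by simp
qed

end
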